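(* Let $\dot q(t)=S(q(t))\,\tilde u(q(t))$ be a driftless control system, where $q(t)\in\mathbb{R}^{n}$ and $S(q)=[S_1(q),S_2(q),\ldots,S_k(q)]\in\mathbb{R}^{n\times k}$ has smooth columns $S_i$. Suppose that (for every $q$) $\|S_i\|=1$ for $i=1,2,\ldots,k$ and $S_i\cdot S_j=0$ for $i\neq j$, where $\|\cdot\|$ is the $l_2$-norm. Let $\rho<0$. Then the controller $\tilde u=(u_1,\ldots,u_k)'$ given by $$u_i(q)=\rho\, q(t)'\cdot S_i(q),\qquad i=1,\ldots,k,$$ stabilizes the system $\dot q(t)=S(q(t))\,\tilde u(q)$, i.e. the resulting closed-loop system is stable at the equilibrium $q=0$.
   Context: A prime denotes transpose. $S_i\cdot S_j$ is the Euclidean inner product of the columns. The state is $q(t)\in\mathbb{R}^{n}$ and the control $\tilde u(q)\in\mathbb{R}^{k}$ is a state feedback that is at least $C^1$. "Stable" and "stabilizes" always refer to stability in the sense of Lyapunov (not asymptotic stability). *)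

theory Defs
  imports "HOL-Analysis.Analysis"
begin

text \<open>Class $C^k$ on the whole space. Continuity of the Frechet derivative is expressed
  through all directional derivatives, which is equivalent as the domain is finite-dimensional.\<close>

primrec Ck :: "nat \<Rightarrow> ('a::euclidean_space \<Rightarrow> 'b::real_normed_vector) \<Rightarrow> bool" where
  "Ck 0 f \<longleftrightarrow> continuous_on UNIV f"
| "Ck (Suc k) f \<longleftrightarrow>
     (\<forall>x. f differentiable (at x)) \<and> (\<forall>v. Ck k (\<lambda>x. frechet_derivative f (at x) v))"

definition smooth :: "('a::euclidean_space \<Rightarrow> 'b::real_normed_vector) \<Rightarrow> bool" where
  "smooth f \<longleftrightarrow> (\<forall>k. Ck k f)"

definition solves_on :: "('a::real_normed_vector \<Rightarrow> 'a) \<Rightarrow> real set \<Rightarrow> (real \<Rightarrow> 'a) \<Rightarrow> bool" where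
  "solves_on f I q \<longleftrightarrow> (\<forall>t\<in>I. (q has_vector_derivative f (q t)) (at t within I))"

text \<open>The stay-close condition is imposed on every solution, on whatever forward time interval
  it is defined; the existence clause says that solutions starting near the equilibrium are
  defined for all $t \geq 0$, so that the condition is not vacuous.\<close>

definition lyapunov_stable :: "('a::real_normed_vector \<Rightarrow> 'a) \<Rightarrow> 'a \<Rightarrow> bool" where
  "lyapunov_stable f xe \<longleftrightarrow>
     f xe = 0 \<and>
     (\<forall>\<epsilon>>0. \<exists>\<delta>>0. \<forall>x0. dist x0 xe < \<delta> \<longrightarrow>
        (\<exists>q. q 0 = x0 \<and> solves_on f {0..} q) \<and>
        (\<forall>I q. is_interval I \<and> 0 \<in> I \<and> I \<subseteq> {0..} \<and> q 0 = x0 \<and> solves_on f I q \<longrightarrow>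
           (\<forall>t\<in>I. dist (q t) xe < \<epsilon>)))"

definition closed_loop ::
  "(real^'n \<Rightarrow> real^'k^'n) \<Rightarrow> (real^'n \<Rightarrow> real^'k) \<Rightarrow> real^'n \<Rightarrow> real^'n" where
  "closed_loop S u q = S q *v u q"

text \<open>Admissible state feedbacks are those of class $C^1$.\<close>

definition stabilizes ::
  "(real^'n \<Rightarrow> real^'k) \<Rightarrow> (real^'n \<Rightarrow> real^'k^'n) \<Rightarrow> real^'n \<Rightarrow> bool" where
  "stabilizes u S xe \<longleftrightarrow> Ck 1 u \<and> lyapunov_stable (closed_loop S u) xe"

end

theory Submission imports Defs begin

text \<open>Along solutions of the closed loop,
  $\frac{d}{dt} \|q\|^2 = 2 \rho \sum_i (q \cdot S_i)^2 \le 0$, so the norm does not increase and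
  $\delta = \epsilon$ works. For global existence, the vector field is composed with the metric
  projection onto a large ball. This makes it globally Lipschitz and keeps $q \cdot \dot q \le 0$,
  so the solution given by the Picard theorem never leaves the ball and solves the original
  equation.\<close>

section \<open>Functions of class $C^1$\<close>

lemma Ck_1_iff:
  "Ck 1 f \<longleftrightarrow> (\<forall>x. f differentiable (at x)) \<and>
     (\<forall>v. continuous_on UNIV (\<lambda>x. frechet_derivative f (at x) v))"
  by simp

text \<open>Derivatives are unique, so an explicit derivative family may stand in for the chosen
  \<open>frechet_derivative\<close>, which then never has to be computed.\<close>

lemma Ck_1I:
  assumes "\<And>x. (f has_derivative f' x) (at x)" "\<And>v. continuous_on UNIV (\<lambda>x. f' x v)"
  shows "Ck 1 f"
proof -
  have "frechet_derivative f (at x) = f' x" for x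
    using frechet_derivative_at[OF assms(1)] by simp
  then show ?thesis
    using assms unfolding Ck_1_iff differentiable_def by auto
qed

lemma Ck_1D:
  assumes "Ck 1 f"
  shows "(f has_derivative frechet_derivative f (at x)) (at x)"
    and "continuous_on UNIV (\<lambda>x. frechet_derivative f (at x) v)"
    and "continuous_on UNIV f"
  using assms
  by (auto simp: Ck_1_iff continuous_on_eq_continuous_at frechet_derivative_works[symmetric]
      intro: differentiable_imp_continuous_within)

lemma Ck_1_const: "Ck 1 (\<lambda>x. c)"
  by (rule Ck_1I[where f' = "\<lambda>x v. 0"]) auto

lemma Ck_1_ident: "Ck 1 (\<lambda>x. x)"
  by (rule Ck_1I[where f' = "\<lambda>x v. v"]) auto

text \<open>Stated for an arbitrary bounded bilinear map, so that one product rule serves real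
  multiplication, the inner product and scaling.\<close>

lemma (in bounded_bilinear) Ck_1_prod:
  assumes "Ck 1 f" "Ck 1 g"
  shows "Ck 1 (\<lambda>x. prod (f x) (g x))"
proof -
  note f = Ck_1D[OF assms(1)] and g = Ck_1D[OF assms(2)]
  show ?thesis
    by (rule Ck_1I[OF FDERIV[OF f(1) g(1)]])
      (intro continuous_on_add continuous_on f(2,3) g(2,3))
qed

lemma Ck_1_sum:
  assumes "\<And>i. i \<in> A \<Longrightarrow> Ck 1 (f i)"
  shows "Ck 1 (\<lambda>x. \<Sum>i\<in>A. f i x)"
proof (rule Ck_1I)
  show "((\<lambda>x. \<Sum>i\<in>A. f i x) has_derivative
      (\<lambda>v. \<Sum>i\<in>A. frechet_derivative (f i) (at x) v)) (at x)" for x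
    by (intro has_derivative_sum Ck_1D(1) assms)
  show "continuous_on UNIV (\<lambda>x. \<Sum>i\<in>A. frechet_derivative (f i) (at x) v)" for v
    by (intro continuous_on_sum Ck_1D(2) assms)
qed

lemma Ck_1_vec_lambda:
  fixes f :: "'i::finite \<Rightarrow> 'a::euclidean_space \<Rightarrow> real"
  assumes "\<And>i. Ck 1 (f i)"
  shows "Ck 1 (\<lambda>x. \<chi> i. f i x)"
proof -
  have "Ck 1 (\<lambda>x. \<Sum>i\<in>UNIV. f i x *\<^sub>R axis i 1)"
    by (intro Ck_1_sum bounded_bilinear.Ck_1_prod[OF bounded_bilinear_scaleR] Ck_1_const assms)
  moreover have "(\<lambda>x. \<chi> i. f i x) = (\<lambda>x. \<Sum>i\<in>UNIV. f i x *\<^sub>R axis i 1)"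
    by (auto simp: fun_eq_iff vec_eq_iff axis_def if_distrib cong: if_cong)
  ultimately show ?thesis
    by simp
qed

text \<open>Continuity of the derivative is available only for each fixed direction. Compactness
  bounds it along each of the finitely many basis vectors, hence in operator norm, and convexity
  allows the mean value inequality.\<close>

lemma Ck_1_lipschitz_on:
  assumes "Ck 1 f" "compact C" "convex C"
  obtains L where "L-lipschitz_on C f"
proof -
  define f' where "f' x = frechet_derivative f (at x)" for x
  note f' = Ck_1D(1,2)[OF assms(1), folded f'_def]
  have "\<exists>B. \<forall>x\<in>C. norm (f' x b) \<le> B" for b
  proof -
    have "bounded ((\<lambda>x. f' x b) ` C)"
      by (intro compact_imp_bounded compact_continuous_image assms(2)
          continuous_on_subset[OF f'(2)] subset_UNIV)
    then show ?thesis
      by (auto simp: bounded_iff)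
  qed
  then obtain B where B: "\<And>b x. x \<in> C \<Longrightarrow> norm (f' x b) \<le> B b"
    by metis
  \<comment> \<open>If \<open>C\<close> is empty, \<open>B b\<close> may be negative; the maximum
    keeps \<open>L\<close> a legitimate Lipschitz constant.\<close>
  define L where "L = (\<Sum>b\<in>Basis. max 0 (B b))"
  have L0: "L \<ge> 0"
    by (auto simp: L_def intro!: sum_nonneg)
  have "onorm (f' x) \<le> L" if "x \<in> C" for x
  proof (rule onorm_le)
    fix v
    interpret f'x: bounded_linear "f' x"
      using f'(1) by (rule has_derivative_bounded_linear)
    have "norm (f' x v) = norm (\<Sum>b\<in>Basis. (v \<bullet> b) *\<^sub>R f' x b)"
      by (subst euclidean_representation[of v, symmetric]) (simp add: f'x.sum f'x.scaleR)
    also have "\<dots> \<le> (\<Sum>b\<in>Basis. norm v * max 0 (B b))"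
      by (intro sum_norm_le) (auto intro!: mult_mono Basis_le_norm B[OF that] le_max_iff_disj[THEN iffD2])
    finally show "norm (f' x v) \<le> L * norm v"
      by (simp add: L_def sum_distrib_left mult.commute)
  qed
  then have "norm (f x - f y) \<le> L * norm (x - y)" if "x \<in> C" "y \<in> C" for x y
    using differentiable_bound[OF assms(3) has_derivative_at_withinI[OF f'(1)]] that by blast
  with L0 have "L-lipschitz_on C f"
    by (simp add: lipschitz_on_def dist_norm)
  then show thesis ..
qed

section \<open>Global existence\<close>

text \<open>Substituting $q(t) = x_0 + e^{ct} y(t)$ with $c$ twice the Lipschitz constant turns the
  Picard operator into a contraction of the bounded continuous functions, on the whole half line at
  once. It is extended to negative times by its value at $0$.\<close>

lemma lipschitz_imp_global_solution:
  fixes g :: "'a::euclidean_space \<Rightarrow> 'a"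
  assumes "L-lipschitz_on UNIV g"
  obtains q where "q 0 = x0" "solves_on g {0..} q"
proof -
  \<comment> \<open>\<open>L\<close> may be 0; the increment makes \<open>c\<close> positive, so
    that dividing by it is harmless.\<close>
  define K where "K = L + 1"
  define c where "c = 2 * K"
  have K: "K > 0" "c > 0"
    using lipschitz_on_nonneg[OF assms] by (auto simp: K_def c_def)
  have lip: "norm (g x - g y) \<le> K * norm (x - y)" for x y
  proof -
    have "norm (g x - g y) \<le> L * norm (x - y)"
      using lipschitz_onD[OF assms, of x y] by (simp add: dist_norm)
    also have "\<dots> \<le> K * norm (x - y)"
      by (simp add: K_def mult_right_mono)
    finally show ?thesis .
  qed
  have gcont: "continuous_on UNIV g"
    using assms by (rule lipschitz_on_continuous_on)
  define h where "h y s = g (x0 + exp (c * s) *\<^sub>R apply_bcontfun y s)" for y and s :: real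
  have hcont: "continuous_on A (h y)" for A y
    unfolding h_def
    by (intro continuous_on_compose2[OF gcont] continuous_intros) auto
  have hint: "h y integrable_on {0..t}" for y t
    by (intro integrable_continuous_real hcont)
  have exp_int: "((\<lambda>s. exp (c * s)) has_integral (exp (c * t) - 1) / c) {0..t}"
    if "t \<ge> 0" for t
  proof -
    have "((\<lambda>s. exp (c * s)) has_integral (exp (c * t) / c - exp (c * 0) / c)) {0..t}"
      using that K
      by (intro fundamental_theorem_of_calculus)
        (auto intro!: derivative_eq_intros simp flip: has_real_derivative_iff_has_vector_derivative)
    then show ?thesis
      by (simp add: diff_divide_distrib)
  qed
  \<comment> \<open>An integrand growing like \<open>exp (c * s)\<close> gains a factor 1/c under
    integration, and the weight cancels the exponential. \<open>M = norm (g x0) + K * norm y\<close>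
    will give boundedness of the Picard image, \<open>M = K * dist y z\<close> the contraction
    factor K/c = 1/2.\<close>
  have weight: "exp (- c * t) * norm (integral {0..t} k) \<le> M / c"
    if "t \<ge> 0" "k integrable_on {0..t}" "\<And>s. s \<in> {0..t} \<Longrightarrow> norm (k s) \<le> M * exp (c * s)" "M \<ge> 0"
    for t M and k :: "real \<Rightarrow> 'a"
  proof -
    have hi: "((\<lambda>s. M * exp (c * s)) has_integral M * ((exp (c * t) - 1) / c)) {0..t}"
      using exp_int[OF that(1)] by (rule has_integral_mult_right)
    have "norm (integral {0..t} k) \<le> integral {0..t} (\<lambda>s. M * exp (c * s))"
      using that hi by (intro integral_norm_bound_integral) auto
    also have "\<dots> = M * ((exp (c * t) - 1) / c)"
      using hi by (rule integral_unique)
    also have "\<dots> \<le> M * (exp (c * t) / c)"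
      using that K by (intro mult_left_mono divide_right_mono) auto
    finally have "exp (- c * t) * norm (integral {0..t} k) \<le> exp (- c * t) * (M * (exp (c * t) / c))"
      by (intro mult_left_mono) auto
    also have "\<dots> = M / c"
      by (simp add: exp_minus field_simps)
    finally show ?thesis .
  qed
  \<comment> \<open>This is the Picard operator in the variable y. Bounded continuous functions live
    on the whole line, hence the clamp \<open>max 0 t\<close>; the value is 0 for t \<le> 0.\<close>
  define P where "P y t = exp (- c * max 0 t) *\<^sub>R integral {0..max 0 t} (h y)" for y t
  have Icont: "continuous_on {0..} (\<lambda>t. integral {0..t} (h y))" for y
  proof -
    have "continuous (at t within {0..}) (\<lambda>t. integral {0..t} (h y))" if "t \<in> {0..}" for t
    proof -
      \<comment> \<open>Indefinite integrals are handled on compact intervals. Ending at t+1 rather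
        than t leaves the one-sided or two-sided neighbourhoods of t in the half line unchanged; the
        derivative of \<open>q\<close> is treated the same way.\<close>
      have "continuous_on {0..t+1} (\<lambda>t. integral {0..t} (h y))"
        by (intro indefinite_integral_continuous_1 hint)
      then have "continuous (at t within {0..t+1}) (\<lambda>t. integral {0..t} (h y))"
        using that by (simp add: continuous_on_eq_continuous_within)
      moreover have "at t within {0..t+1} = at t within {0..}"
        using that by (intro at_within_nhd[of t "{..<t+1}"]) auto
      ultimately show ?thesis
        by simp
    qed
    then show ?thesis
      by (simp add: continuous_on_eq_continuous_within)
  qed
  have Pcont: "continuous_on UNIV (P y)" for y
    unfolding P_def
    by (intro continuous_intros continuous_on_compose2[OF Icont]) auto
  have Pbd: "norm (P y t) \<le> (norm (g x0) + K * norm y) / c" for y t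
  proof -
    have "exp (- c * max 0 t) * norm (integral {0..max 0 t} (h y)) \<le> (norm (g x0) + K * norm y) / c"
    proof (rule weight)
      fix s assume s: "s \<in> {0..max 0 t}"
      have "norm (h y s) \<le> norm (g x0) + norm (h y s - g x0)"
        by (metis norm_triangle_sub)
      also have "\<dots> \<le> norm (g x0) + K * norm (exp (c * s) *\<^sub>R apply_bcontfun y s)"
        using lip[of "x0 + exp (c * s) *\<^sub>R apply_bcontfun y s" x0] by (simp add: h_def)
      \<comment> \<open>For s \<ge> 0 the exponential is at least 1, so the constant term also fits
        the growth required by \<open>weight\<close>.\<close>
      also have "\<dots> \<le> norm (g x0) * exp (c * s) + K * (exp (c * s) * norm y)"
        using s K
        by (auto intro!: add_mono mult_left_mono norm_bounded simp: mult_le_cancel_left1)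
      finally show "norm (h y s) \<le> (norm (g x0) + K * norm y) * exp (c * s)"
        by (simp add: algebra_simps)
    qed (use K hint in auto)
    then show ?thesis
      by (simp add: P_def)
  qed
  have Pbc: "P y \<in> bcontfun" for y
    using Pcont Pbd by (intro bcontfun_normI) auto
  define \<Phi> where "\<Phi> y = Bcontfun (P y)" for y
  have \<Phi>: "apply_bcontfun (\<Phi> y) t = P y t" for y t
    by (simp add: \<Phi>_def Bcontfun_inverse[OF Pbc])
  have contr: "dist (\<Phi> y) (\<Phi> z) \<le> 1/2 * dist y z" for y z
  proof (rule dist_bound)
    fix t
    have "exp (- c * max 0 t) * norm (integral {0..max 0 t} (\<lambda>s. h y s - h z s)) \<le> (K * dist y z) / c"
    proof (rule weight)
      fix s
      have "norm (h y s - h z s)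
          \<le> K * norm (exp (c * s) *\<^sub>R apply_bcontfun y s - exp (c * s) *\<^sub>R apply_bcontfun z s)"
        using lip[of "x0 + exp (c * s) *\<^sub>R apply_bcontfun y s" "x0 + exp (c * s) *\<^sub>R apply_bcontfun z s"]
        by (simp add: h_def)
      also have "\<dots> = K * (exp (c * s) * dist (apply_bcontfun y s) (apply_bcontfun z s))"
        by (simp add: dist_norm flip: scaleR_diff_right)
      also have "\<dots> \<le> K * (exp (c * s) * dist y z)"
        using K by (intro mult_left_mono dist_bounded) auto
      finally show "norm (h y s - h z s) \<le> K * dist y z * exp (c * s)"
        by (simp add: algebra_simps)
    qed (use K hint in \<open>auto intro: integrable_diff\<close>)
    moreover have "P y t - P z t
        = exp (- c * max 0 t) *\<^sub>R integral {0..max 0 t} (\<lambda>s. h y s - h z s)"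
      by (simp add: P_def integral_diff[OF hint hint] scaleR_diff_right)
    ultimately show "dist (apply_bcontfun (\<Phi> y) t) (apply_bcontfun (\<Phi> z) t) \<le> 1/2 * dist y z"
      using K by (simp add: \<Phi> dist_norm c_def)
  qed
  obtain y where y: "\<Phi> y = y"
    using banach_fix_type[of "1/2" \<Phi>] contr by auto
  define q where "q t = x0 + integral {0..t} (h y)" for t
  \<comment> \<open>Multiplied by \<open>exp (c * t)\<close>, the fixed point equation says that
    \<open>q t - x0\<close> is the rescaled y, so the integrand defining \<open>q\<close> is the
    field along \<open>q\<close> itself.\<close>
  have h_eq: "h y t = g (q t)" if "t \<ge> 0" for t
  proof -
    have "exp (c * t) *\<^sub>R apply_bcontfun y t = exp (c * t) *\<^sub>R P y t"
      using \<Phi>[of y t] by (simp add: y)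
    also have "\<dots> = integral {0..t} (h y)"
      using that by (simp add: P_def flip: exp_add)
    finally show ?thesis
      by (simp add: h_def q_def)
  qed
  have "(q has_vector_derivative g (q t)) (at t within {0..})" if "t \<in> {0..}" for t
  proof -
    have "((\<lambda>t. integral {0..t} (h y)) has_vector_derivative h y t) (at t within {0..t+1})"
      using that by (intro integral_has_vector_derivative hcont) auto
    moreover have "at t within {0..t+1} = at t within {0..}"
      using that by (intro at_within_nhd[of t "{..<t+1}"]) auto
    ultimately have "(q has_vector_derivative h y t) (at t within {0..})"
      unfolding q_def by (auto intro!: derivative_eq_intros)
    with h_eq that show ?thesis
      by simp
  qed
  then have "solves_on g {0..} q"
    by (simp add: solves_on_def)
  moreover have "q 0 = x0"
    by (simp add: q_def)
  ultimately show thesis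
    using that by blast
qed

section \<open>Dissipative vector fields\<close>

text \<open>The mean value theorem is applied to the squared norm, which, unlike the norm, is
  differentiable also where the solution vanishes.\<close>

lemma solves_on_norm_le:
  fixes f :: "'a::real_inner \<Rightarrow> 'a"
  assumes diss: "\<And>x. x \<bullet> f x \<le> 0"
    and sol: "solves_on f I q" and I: "is_interval I" "0 \<in> I" "t \<in> I" "0 \<le> t"
  shows "norm (q t) \<le> norm (q 0)"
proof -
  have sub: "{0..t} \<subseteq> I"
    using mem_is_interval_1_I[OF I(1-3)] by auto
  have "((\<lambda>s. q s \<bullet> q s) has_derivative (\<lambda>h. h * (2 * (q s \<bullet> f (q s))))) (at s within {0..t})"
    if "0 \<le> s" "s \<le> t" for s
  proof -
    have "(q has_vector_derivative f (q s)) (at s within {0..t})"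
      using sol sub that unfolding solves_on_def
      by (intro has_vector_derivative_within_subset[OF _ sub]) auto
    then show ?thesis
      unfolding has_vector_derivative_def
      by (auto intro!: derivative_eq_intros simp: inner_commute)
  qed
  from mvt_very_simple[OF \<open>0 \<le> t\<close> this]
  obtain s where "q t \<bullet> q t - q 0 \<bullet> q 0 = (t - 0) * (2 * (q s \<bullet> f (q s)))"
    by auto
  also have "\<dots> \<le> 0"
    using \<open>0 \<le> t\<close> diss[of "q s"] by (auto intro!: mult_nonneg_nonpos)
  finally show ?thesis
    by (simp add: norm_le)
qed

lemma dissipative_global_solution:
  fixes f :: "'a::euclidean_space \<Rightarrow> 'a"
  assumes C1: "Ck 1 f" and diss: "\<And>x. x \<bullet> f x \<le> 0"
  obtains q where "q 0 = x0" "solves_on f {0..} q"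
proof -
  \<comment> \<open>The radius is positive even for \<open>x0 = 0\<close>, and the ball contains
    every point of norm at most \<open>norm x0\<close>.\<close>
  define R where "R = norm x0 + 1"
  have R: "R > 0"
    by (simp add: R_def add_nonneg_pos)
  define \<pi> where "\<pi> = closest_point (cball (0::'a) R)"
  have ne: "cball (0::'a) R \<noteq> {}"
    using R by simp
  obtain L where L: "L-lipschitz_on (cball 0 R) f"
    using Ck_1_lipschitz_on[OF C1 compact_cball convex_cball] .
  have \<pi>_lip: "1-lipschitz_on UNIV \<pi>"
    unfolding \<pi>_def
    using closest_point_lipschitz[OF convex_cball closed_cball ne] by (auto intro: lipschitz_onI)
  have \<pi>_in: "\<pi> x \<in> cball 0 R" for x
    unfolding \<pi>_def using ne by (intro closest_point_in_set) auto
  have "(L * 1)-lipschitz_on UNIV (\<lambda>x. f (\<pi> x))"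
    by (intro lipschitz_on_compose2[OF \<pi>_lip]) (use L \<pi>_in in \<open>auto intro: lipschitz_on_subset\<close>)
  then obtain q where q: "q 0 = x0" "solves_on (\<lambda>x. f (\<pi> x)) {0..} q"
    by (rule lipschitz_imp_global_solution)
  \<comment> \<open>The ball is centred at the origin, so the projection is radial: outside the
    ball, x is a positive multiple of its projection p, and the sign of
    \<open>p \<bullet> f p\<close> carries over.\<close>
  have diss': "x \<bullet> f (\<pi> x) \<le> 0" for x
  proof (cases "norm x \<le> R")
    case True
    then have "\<pi> x = x"
      by (simp add: \<pi>_def closest_point_self)
    with diss show ?thesis
      by simp
  next
    case False
    \<comment> \<open>The radial candidate is nearest because every z in the ball satisfies dist x z
      \<ge> norm x - norm z \<ge> norm x - R, with equality at p.\<close>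
    define p where "p = (R / norm x) *\<^sub>R x"
    have "p = \<pi> x"
      unfolding \<pi>_def
    proof (rule closest_point_unique)
      show "p \<in> cball 0 R"
        using False R by (simp add: p_def)
      have "x - p = (1 - R / norm x) *\<^sub>R x"
        by (simp add: p_def algebra_simps)
      moreover have "R / norm x \<le> 1"
        using False R by (simp add: divide_le_eq_1)
      ultimately have "dist x p = (1 - R / norm x) * norm x"
        by (simp add: dist_norm)
      also have "\<dots> = norm x - R"
        using False R by (auto simp: left_diff_distrib)
      also have "\<dots> \<le> dist x z" if "z \<in> cball 0 R" for z
        using that norm_triangle_ineq2[of x z] by (simp add: dist_norm)
      finally show "\<forall>z\<in>cball 0 R. dist x p \<le> dist x z"
        by blast
    qed auto
    moreover have "x = (norm x / R) *\<^sub>R p"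
      using False R by (auto simp: p_def)
    ultimately have "x \<bullet> f (\<pi> x) = (norm x / R) * (p \<bullet> f p)"
      by (metis inner_scaleR_left)
    then show ?thesis
      using R diss[of p] by (simp only:) (intro mult_nonneg_nonpos divide_nonneg_pos norm_ge_zero)
  qed
  have "\<pi> (q t) = q t" if "t \<ge> 0" for t
  proof -
    have "norm (q t) \<le> norm x0"
      using solves_on_norm_le[OF diss' q(2), of t] that q(1) by simp
    then show ?thesis
      by (simp add: \<pi>_def closest_point_self R_def)
  qed
  with q have "solves_on f {0..} q"
    by (simp add: solves_on_def)
  with q(1) show thesis
    using that by blast
qed

lemma dissipative_lyapunov_stable:
  fixes f :: "'a::euclidean_space \<Rightarrow> 'a"
  assumes "Ck 1 f" and diss: "\<And>x. x \<bullet> f x \<le> 0" and "f 0 = 0"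
  shows "lyapunov_stable f 0"
proof -
  have "norm (q t) < \<epsilon>" if "is_interval I" "0 \<in> I" "I \<subseteq> {0..}" "solves_on f I q" "t \<in> I" "norm (q 0) < \<epsilon>"
    for \<epsilon> I q and t :: real
    using solves_on_norm_le[OF diss that(4,1,2,5)] that(3,5,6) by auto
  moreover have "\<exists>q. q 0 = x0 \<and> solves_on f {0..} q" for x0
    using dissipative_global_solution[OF assms(1,2)] by metis
  ultimately show ?thesis
    using assms(3) unfolding lyapunov_stable_def dist_0_norm dist_commute[of _ 0] by blast
qed

section \<open>The closed-loop system\<close>

theorem theorem4p0p3:
  fixes S :: "real^'n \<Rightarrow> real^'k^'n" and \<rho> :: real
  assumes smooth_columns: "\<And>i. smooth (\<lambda>q. column i (S q))"
    and unit_columns: "\<And>q i. norm (column i (S q)) = 1"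
    and orthogonal_columns: "\<And>q i j. i \<noteq> j \<Longrightarrow> column i (S q) \<bullet> column j (S q) = 0"
    and rho_neg: "\<rho> < 0"
  shows "stabilizes (\<lambda>q. \<chi> i. \<rho> * (q \<bullet> column i (S q))) S 0"
proof -
  let ?u = "\<lambda>q. \<chi> i. \<rho> * (q \<bullet> column i (S q))"
  have S: "Ck 1 (\<lambda>q. column i (S q))" for i
    using smooth_columns by (simp only: smooth_def)
  have u: "Ck 1 (\<lambda>q. \<rho> * (q \<bullet> column i (S q)))" for i
    by (intro bounded_bilinear.Ck_1_prod[OF bounded_bilinear_mult]
        bounded_bilinear.Ck_1_prod[OF bounded_bilinear_inner] Ck_1_const Ck_1_ident S)
  \<comment> \<open>For orthonormal columns this is \<rho> times the orthogonal projection of q onto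
    their span. Written columnwise, it is visibly of class C^1, and pairing it with q yields \<rho>
    times a sum of squares.\<close>
  have cl: "closed_loop S ?u = (\<lambda>q. \<Sum>i\<in>UNIV. (\<rho> * (q \<bullet> column i (S q))) *\<^sub>R column i (S q))"
    by (simp add: closed_loop_def matrix_mult_sum scalar_mult_eq_scaleR fun_eq_iff)
  have "lyapunov_stable (closed_loop S ?u) 0"
  proof (rule dissipative_lyapunov_stable)
    show "Ck 1 (closed_loop S ?u)"
      unfolding cl
      by (intro Ck_1_sum bounded_bilinear.Ck_1_prod[OF bounded_bilinear_scaleR] u S)
    show "closed_loop S ?u 0 = 0"
      by (simp add: cl)
    fix q
    have "q \<bullet> closed_loop S ?u q = (\<Sum>i\<in>UNIV. \<rho> * (q \<bullet> column i (S q))\<^sup>2)"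
      by (simp add: cl inner_sum_right power2_eq_square mult.assoc)
    also have "\<dots> \<le> 0"
      using rho_neg by (intro sum_nonpos) (simp add: mult_nonpos_nonneg)
    finally show "q \<bullet> closed_loop S ?u q \<le> 0" .
  qed
  moreover have "Ck 1 ?u"
    by (intro Ck_1_vec_lambda u)
  ultimately show ?thesis
    by (simp only: stabilizes_def simp_thms)
qed

end
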